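(* Consider a sequence of sparse linear regression problems $y = X\beta^* + w$ indexed by the dimension $p$, satisfying the standing assumptions in the context, with $\rho_{2k}>0$. Let SWAP be initialized with a support $S^{(1)} \subset [p]$ such that $|S^{(1)}| = k$ and $|S^* \setminus S^{(1)}| \le 1$, and let $\widehat{S}$ be the output of SWAP. If $$ n > \frac{4 + \log\big(k^2 (p-k)\big)}{c^2 \beta_{\min}^2 \rho_{2k}/2}, $$ where $c$ is a constant with $0 < c^2 \le 1/(18\sigma^2)$, then $\Pr(\widehat{S} = S^* ) \to 1$ as $p \to \infty$.
   Context: Setting. $[p]=\{1,\dots,p\}$. One observes $y \in \mathbb{R}^n$ and $X \in \mathbb{R}^{n\times p}$ with $y = X\beta^* + w$, under the standing assumptions: (1) $\beta^*\in\mathbb{R}^p$ is $k$-sparse with support $S^*$, $|S^*|=k$; (2) $X$ is deterministic with columns satisfying $\|X_i\|_2^2/n = 1$ for all $i\in[p]$; (3) the entries of $w$ are i.i.d. zero-mean sub-Gaussian with parameter $\sigma$, i.e. $\mathbb{E}[\exp(t w_i)] \le \exp(t^2\sigma^2/2)$ for all $t\in\mathbb{R}$; (4) $n \ge k$; (5) $n$ and $k$ (and $X,\beta^*$) may vary with $p$ and $n,k$ are allowed to grow to infinity as $p\to\infty$. Loss. For $S\subset[p]$, $X_S$ is the submatrix of the columns of $X$ indexed by $S$, and $\mathcal{L}(S;y,X) = \min_{\alpha\in\mathbb{R}^{|S|}}\|y-X_S\alpha\|_2^2$. SWAP. Given an initial support $S^{(1)}$, set $r=1$. At step $r$, compute $L^{(r)}_{i,i'}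 = \mathcal{L}\big((S^{(r)}\setminus\{i\})\cup\{i'\};y,X\big)$ for all $i\in S^{(r)}$, $i'\in (S^{(r)})^c$. If $\min_{i,i'}L^{(r)}_{i,i'} < \mathcal{L}(S^{(r)};y,X)$, let $(\hat i,\hat i')$ be a minimizing pair (ties broken arbitrarily), set $S^{(r+1)} = (S^{(r)}\setminus\{\hat i\})\cup\{\hat i'\}$, increase $r$ by one and repeat. Otherwise stop and return $\widehat S = S^{(r)}$. Parameters. $\beta_{\min} = \min_{i\in S^*}|\beta^*_i|$, and $$\rho_{k+\ell} = \inf\left\{\frac{\|X\theta\|_2^2}{n\|\theta\|_2^2} : \|\theta\|_0\le k+\ell,\ S^*\subseteq \mathrm{supp}(\theta)\right\},$$ so $\rho_{2k}$ is the case $\ell = k$. Here $\|\theta\|_0$ is the number of non-zero entries of $\theta$ and $\mathrm{supp}(\theta)$ their locations. *)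

theory Defs
  imports "HOL-Probability.Probability" "Jordan_Normal_Form.DL_Submatrix"
begin

unbundle no vec_syntax
unbundle no inner_syntax

(* Matrices and vectors are those of Jordan_Normal_Form, so that dimensions are
   natural numbers that may vary along a sequence of problems.  Their indices start
   at 0: the index set [p] = {1, ..., p} is rendered as {..<p}. *)

definition support :: "real vec \<Rightarrow> nat set" where
  "support v = {i. i < dim_vec v \<and> v $ i \<noteq> 0}"

definition sq_norm2 :: "real vec \<Rightarrow> real" where
  "sq_norm2 v = v \<bullet> v"

(* The infimum is attained: it is the squared distance from y to the span of the
   selected columns. *)
definition loss :: "real vec \<Rightarrow> real mat \<Rightarrow> nat set \<Rightarrow> real" where
  "loss y X S = (INF \<alpha>\<in>carrier_vec (card S). sq_norm2 (y - submatrix X UNIV S *\<^sub>v \<alpha>))"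

definition exchange :: "nat set \<Rightarrow> nat \<times> nat \<Rightarrow> nat set" where
  "exchange S = (\<lambda>(i, i'). insert i' (S - {i}))"

definition exchange_pairs :: "real mat \<Rightarrow> nat set \<Rightarrow> (nat \<times> nat) set" where
  "exchange_pairs X S = S \<times> ({..<dim_col X} - S)"

(* "swap_output y X S T": the algorithm, started from S, can return T.  It is a
   relation, not a function, because ties between minimizing pairs are broken
   arbitrarily.  If there are no pairs at all, the algorithm stops. *)
inductive swap_output :: "real vec \<Rightarrow> real mat \<Rightarrow> nat set \<Rightarrow> nat set \<Rightarrow> bool"
  for y :: "real vec" and X :: "real mat" where
  stop: "(\<And>q. q \<in> exchange_pairs X S \<Longrightarrow> \<not> loss y X (exchange S q) < loss y X S)
    \<Longrightarrow> swap_output y X S S"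
| step: "is_arg_min (\<lambda>q. loss y X (exchange S q)) (\<lambda>q. q \<in> exchange_pairs X S) q
    \<Longrightarrow> loss y X (exchange S q) < loss y X S
    \<Longrightarrow> swap_output y X (exchange S q) T \<Longrightarrow> swap_output y X S T"

(* The algorithm terminates, because the loss strictly decreases. *)
lemma swap_output_exists:
  assumes "S \<subseteq> {..<dim_col X}"
  shows "\<exists>T. swap_output y X S T"
  using assms
proof (induction "card {S' \<in> Pow {..<dim_col X}. loss y X S' < loss y X S}"
    arbitrary: S rule: less_induct)
  case less
  let ?P = "exchange_pairs X S" and ?f = "\<lambda>q. loss y X (exchange S q)"
  show ?case
  proof (cases "\<exists>q\<in>?P. ?f q < loss y X S")
    case False
    then show ?thesis by (blast intro: swap_output.stop)
  next
    case True
    have "finite ?P" "?P \<noteq> {}"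
      using True finite_subset[OF less.prems] by (auto simp: exchange_pairs_def)
    then obtain q where q: "is_arg_min ?f (\<lambda>q. q \<in> ?P) q"
      using ex_is_arg_min_if_finite by blast
    then have qP: "q \<in> ?P" and qmin: "\<And>r. r \<in> ?P \<Longrightarrow> ?f q \<le> ?f r"
      by (auto simp: is_arg_min_linorder)
    have dec: "?f q < loss y X S"
      using True qmin by (meson le_less_trans)
    let ?D = "\<lambda>S. {S' \<in> Pow {..<dim_col X}. loss y X S' < loss y X S}"
    have sub: "exchange S q \<subseteq> {..<dim_col X}"
      using qP less.prems by (auto simp: exchange_def exchange_pairs_def)
    then have "?D (exchange S q) \<subset> ?D S"
      using dec by (auto intro: less_trans)
    then have "card (?D (exchange S q)) < card (?D S)"
      by (intro psubset_card_mono) auto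
    from less.hyps[OF this sub] show ?thesis
      using swap_output.step[OF q dec] by blast
  qed
qed

definition beta_min :: "real vec \<Rightarrow> real" where
  "beta_min \<beta> = Min ((\<lambda>i. \<bar>\<beta> $ i\<bar>) ` support \<beta>)"

(* With S the true support and card S = k, this is rho_m for m = k + l. *)
definition rho :: "real mat \<Rightarrow> nat set \<Rightarrow> nat \<Rightarrow> real" where
  "rho X S m = Inf {sq_norm2 (X *\<^sub>v \<theta>) / (real (dim_row X) * sq_norm2 \<theta>) | \<theta>.
     \<theta> \<in> carrier_vec (dim_col X) \<and> card (support \<theta>) \<le> m \<and> S \<subseteq> support \<theta>}"

definition zero_mean_sub_gaussian :: "'a measure \<Rightarrow> real \<Rightarrow> ('a \<Rightarrow> real) \<Rightarrow> bool" where
  "zero_mean_sub_gaussian M \<sigma> Z \<longleftrightarrow>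
     integrable M Z \<and> integral\<^sup>L M Z = 0 \<and>
     (\<forall>t. integrable M (\<lambda>\<omega>. exp (t * Z \<omega>)) \<and>
          integral\<^sup>L M (\<lambda>\<omega>. exp (t * Z \<omega>)) \<le> exp (t\<^sup>2 * \<sigma>\<^sup>2 / 2))"

locale sparse_regression = prob_space M
  for M :: "'a measure" +
  fixes p n k :: nat and \<sigma> :: real and X :: "real mat" and \<beta> :: "real vec"
    and w y :: "'a \<Rightarrow> real vec"
  assumes X_carrier: "X \<in> carrier_mat n p"
    and beta_carrier: "\<beta> \<in> carrier_vec p"
    and w_carrier: "\<And>\<omega>. \<omega> \<in> space M \<Longrightarrow> w \<omega> \<in> carrier_vec n"
    and y_eq: "\<And>\<omega>. \<omega> \<in> space M \<Longrightarrow> y \<omega> = X *\<^sub>v \<beta> + w \<omega>"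
    and card_support: "card (support \<beta>) = k"
    and k_pos: "1 \<le> k"  (* needed for beta_min to be defined *)
    and k_le_n: "k \<le> n"
    and columns_normalized: "\<And>i. i < p \<Longrightarrow> sq_norm2 (col X i) / real n = 1"
    and noise_indep: "indep_vars (\<lambda>_. borel) (\<lambda>j \<omega>. w \<omega> $ j) {..<n}"
    and noise_identical: "\<And>i j. i < n \<Longrightarrow> j < n \<Longrightarrow>
      distr M borel (\<lambda>\<omega>. w \<omega> $ i) = distr M borel (\<lambda>\<omega>. w \<omega> $ j)"
    and noise_sub_gaussian: "\<And>j. j < n \<Longrightarrow> zero_mean_sub_gaussian M \<sigma> (\<lambda>\<omega>. w \<omega> $ j)"

end

theory Submission
  imports Defs "HOL-Real_Asymp.Real_Asymp"
begin

text \<open>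
  Let \<open>T\<close> be the true support and let \<open>S\<close> have the same size and miss \<open>l\<close> elements of \<open>T\<close>.
  Comparing both projections with the one onto the columns in \<open>S \<inter> T\<close> gives
  \<open>loss S - loss T \<ge> |v|\<^sup>2 + 2 (v \<bullet> w) - \<Sum> (u\<^sub>b \<bullet> w)\<^sup>2\<close>, where \<open>v\<close> is the residual of \<open>X \<beta>\<close> on \<open>S\<close>,
  the sum has \<open>l\<close> terms and the \<open>u\<^sub>b\<close> have length at most 1. Since \<open>|v|\<^sup>2 \<ge> n \<rho> l \<beta>_min\<^sup>2\<close>,
  sub-Gaussian tails bound the probability that this is not positive by \<open>5 exp (- 2 l L)\<close> with
  \<open>L = 4 + ln (k\<^sup>2 (p - k))\<close>, while there are at most \<open>(k (p - k))\<^sup>l\<close> such sets. A union bound over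
  \<open>l \<in> {1, 2}\<close> makes \<open>T\<close> the strict minimizer among all sets missing at most two elements of \<open>T\<close>.
  These include every exchange SWAP considers from a set missing at most one, so SWAP
  moves to \<open>T\<close> in its first step, unless it is there already, and stops. Taking the union over
  all sets at distance 2 allows the initial support to depend on the noise.
\<close>

subsection \<open>Least-squares residuals\<close>

text \<open>Column selections are encoded by coefficient vectors of full length that vanish outside the
  selected set, so that different selections share one coefficient space.\<close>

definition coeff_vecs :: "nat \<Rightarrow> nat set \<Rightarrow> real vec set" where
  "coeff_vecs p A = {\<theta> \<in> carrier_vec p. support \<theta> \<subseteq> A}"

lemma coeff_vecs_iff: "\<theta> \<in> coeff_vecs p A \<longleftrightarrow> \<theta> \<in> carrier_vec p \<and> (\<forall>i<p. i \<notin> A \<longrightarrow> \<theta> $ i = 0)"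
  by (auto simp: coeff_vecs_def support_def)

lemma coeff_vecs_carrier: "\<theta> \<in> coeff_vecs p A \<Longrightarrow> \<theta> \<in> carrier_vec p"
  by (simp add: coeff_vecs_def)

lemma coeff_vecs_mono: "\<theta> \<in> coeff_vecs p A \<Longrightarrow> A \<subseteq> B \<Longrightarrow> \<theta> \<in> coeff_vecs p B"
  by (auto simp: coeff_vecs_iff)

lemma coeff_vecs_unit: "i \<in> A \<Longrightarrow> unit_vec p i \<in> coeff_vecs p A"
  by (auto simp: coeff_vecs_iff unit_vec_def)

lemma coeff_vecs_add: "\<theta> \<in> coeff_vecs p A \<Longrightarrow> \<eta> \<in> coeff_vecs p A \<Longrightarrow> \<theta> + \<eta> \<in> coeff_vecs p A"
  by (auto simp: coeff_vecs_iff)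

lemma coeff_vecs_minus: "\<theta> \<in> coeff_vecs p A \<Longrightarrow> \<eta> \<in> coeff_vecs p A \<Longrightarrow> \<theta> - \<eta> \<in> coeff_vecs p A"
  by (auto simp: coeff_vecs_iff)

lemma coeff_vecs_smult: "\<theta> \<in> coeff_vecs p A \<Longrightarrow> c \<cdot>\<^sub>v \<theta> \<in> coeff_vecs p A"
  by (auto simp: coeff_vecs_iff)

lemma coeff_vecs_insert_split:
  assumes "\<theta> \<in> coeff_vecs p (insert j A)" "j < p"
  obtains \<eta> c where "\<eta> \<in> coeff_vecs p A" "\<theta> = \<eta> + c \<cdot>\<^sub>v unit_vec p j"
proof
  show "\<theta> - \<theta> $ j \<cdot>\<^sub>v unit_vec p j \<in> coeff_vecs p A"
    using assms by (auto simp: coeff_vecs_iff)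
  show "\<theta> = \<theta> - \<theta> $ j \<cdot>\<^sub>v unit_vec p j + \<theta> $ j \<cdot>\<^sub>v unit_vec p j"
    using assms by (intro eq_vecI) (auto simp: coeff_vecs_iff)
qed

lemma mult_mat_unit_vec:
  assumes "(X :: real mat) \<in> carrier_mat n p" "j < p"
  shows "X *\<^sub>v unit_vec p j = col X j"
  using assms by (intro eq_vecI) auto

lemma sq_norm2_nonneg: "0 \<le> sq_norm2 v"
  by (auto simp: sq_norm2_def scalar_prod_def intro: sum_nonneg)

lemma sq_norm2_eq_0_iff:
  assumes "v \<in> carrier_vec n" shows "sq_norm2 v = 0 \<longleftrightarrow> v = 0\<^sub>v n"
proof
  assume "sq_norm2 v = 0"
  then have "\<forall>i\<in>{0..<dim_vec v}. v $ i * v $ i = 0"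
    by (subst (asm) sq_norm2_def, unfold scalar_prod_def, subst (asm) sum_nonneg_eq_0_iff) auto
  then show "v = 0\<^sub>v n" using assms by (intro eq_vecI) auto
qed (use assms in \<open>auto simp: sq_norm2_def\<close>)

section \<open>Residuals of orthogonal projections onto column spans\<close>

text \<open>\<open>r\<close> is the part of \<open>y\<close> orthogonal to the span of the columns
  in \<open>A\<close>. Naming the residual rather than a coefficient vector keeps it unique even
  when those columns are linearly dependent.\<close>

definition is_resid :: "real mat \<Rightarrow> nat set \<Rightarrow> real vec \<Rightarrow> real vec \<Rightarrow> bool" where
  "is_resid X A y r \<longleftrightarrow> (\<exists>\<theta>\<in>coeff_vecs (dim_col X) A. r = y - X *\<^sub>v \<theta>) \<and>
     (\<forall>\<theta>\<in>coeff_vecs (dim_col X) A. r \<bullet> (X *\<^sub>v \<theta>) = 0)"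

context
  fixes X :: "real mat" and n p :: nat
  assumes X: "X \<in> carrier_mat n p"
begin

lemma dim_X: "dim_col X = p" "dim_row X = n"
  using X by auto

lemma X_mult_carrier: "\<theta> \<in> coeff_vecs p A \<Longrightarrow> X *\<^sub>v \<theta> \<in> carrier_vec n"
  using X coeff_vecs_carrier by (metis mult_mat_vec_carrier)

lemma is_resid_carrier: "is_resid X A y r \<Longrightarrow> y \<in> carrier_vec n \<Longrightarrow> r \<in> carrier_vec n"
  using X_mult_carrier by (auto simp: is_resid_def dim_X)

lemma is_resid_empty:
  assumes "y \<in> carrier_vec n"
  shows "is_resid X {} y y"
proof -
  have *: "coeff_vecs p {} = {0\<^sub>v p}" by (auto simp: coeff_vecs_iff intro!: eq_vecI)
  have "X *\<^sub>v 0\<^sub>v p = 0\<^sub>v n" using X by (intro eq_vecI) auto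
  then show ?thesis using assms by (auto simp: is_resid_def dim_X *)
qed

text \<open>One Gram-Schmidt step: \<open>z\<close> is the component of column \<open>j\<close>
  orthogonal to the columns in \<open>A\<close>, so enlarging \<open>A\<close> by \<open>j\<close>
  only removes from \<open>r\<close> its component along \<open>z\<close>.\<close>

lemma is_resid_insert:
  assumes y: "y \<in> carrier_vec n" and j: "j < p"
    and r: "is_resid X A y r" and z: "is_resid X A (col X j) z"
  shows "is_resid X (insert j A) y (r - ((r \<bullet> z) / (z \<bullet> z)) \<cdot>\<^sub>v z)"
proof -
  let ?c = "(r \<bullet> z) / (z \<bullet> z)"
  have cj: "col X j \<in> carrier_vec n" using X by (intro carrier_vecI) simp
  note rc = is_resid_carrier[OF r y] and zc = is_resid_carrier[OF z cj]
  obtain \<theta> where \<theta>: "\<theta> \<in> coeff_vecs p A" "r = y - X *\<^sub>v \<theta>"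
    using r by (auto simp: is_resid_def dim_X)
  obtain \<zeta> where \<zeta>: "\<zeta> \<in> coeff_vecs p A" "z = col X j - X *\<^sub>v \<zeta>"
    using z by (auto simp: is_resid_def dim_X)
  have uc: "unit_vec p j \<in> carrier_vec p" by simp
  let ?\<eta> = "\<theta> + ?c \<cdot>\<^sub>v (unit_vec p j - \<zeta>)"
  have sub: "A \<subseteq> insert j A" by blast
  have \<eta>: "?\<eta> \<in> coeff_vecs p (insert j A)"
    by (intro coeff_vecs_add coeff_vecs_smult coeff_vecs_minus coeff_vecs_unit coeff_vecs_mono[OF \<theta>(1) sub]
        coeff_vecs_mono[OF \<zeta>(1) sub]) simp
  have "X *\<^sub>v ?\<eta> = X *\<^sub>v \<theta> + ?c \<cdot>\<^sub>v z"
    using coeff_vecs_carrier[OF \<theta>(1)] coeff_vecs_carrier[OF \<zeta>(1)] X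
    by (simp add: mult_add_distrib_mat_vec[OF X] mult_mat_vec[OF X] mult_minus_distrib_mat_vec[OF X]
        mult_mat_unit_vec[OF X j] \<zeta>(2))
  then have eq: "r - ?c \<cdot>\<^sub>v z = y - X *\<^sub>v ?\<eta>"
    using y rc zc X_mult_carrier[OF \<theta>(1)] by (intro eq_vecI) (auto simp: \<theta>(2) dest!: carrier_vecD)
  have dc: "r - ?c \<cdot>\<^sub>v z \<in> carrier_vec n" using rc zc by simp
  \<comment> \<open>If column \<open>j\<close> already lies in the span of the others, then
    \<open>z = 0\<close> and division by zero gives \<open>?c = 0\<close>; the residual then stays
    as it is.\<close>
  have zz: "?c * (z \<bullet> z) = r \<bullet> z"
  proof (cases "z \<bullet> z = 0")
    case True
    then have "z = 0\<^sub>v n" using sq_norm2_eq_0_iff[OF zc] by (simp add: sq_norm2_def)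
    then show ?thesis using rc True by simp
  qed auto
  have orth: "(r - ?c \<cdot>\<^sub>v z) \<bullet> (X *\<^sub>v \<theta>') = 0" if \<theta>': "\<theta>' \<in> coeff_vecs p A" for \<theta>'
    using r z \<theta>' rc zc X_mult_carrier[OF \<theta>']
    by (simp add: is_resid_def dim_X minus_scalar_prod_distrib[of _ n])
  have "(r - ?c \<cdot>\<^sub>v z) \<bullet> z = 0"
    using zz rc zc by (simp add: minus_scalar_prod_distrib[of _ n])
  \<comment> \<open>Orthogonality to column \<open>j\<close> is checked on its two components,
    \<open>z\<close> and a vector in the span of \<open>A\<close>.\<close>
  moreover have "col X j = z + X *\<^sub>v \<zeta>"
    using cj X_mult_carrier[OF \<zeta>(1)] by (auto simp: \<zeta>(2))
  ultimately have orthj: "(r - ?c \<cdot>\<^sub>v z) \<bullet> col X j = 0"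
    using orth[OF \<zeta>(1)] rc zc X_mult_carrier[OF \<zeta>(1)]
    by (simp add: scalar_prod_add_distrib[of _ n])
  show ?thesis unfolding is_resid_def dim_X
  proof (intro conjI ballI)
    show "\<exists>\<theta>\<in>coeff_vecs p (insert j A). r - ?c \<cdot>\<^sub>v z = y - X *\<^sub>v \<theta>"
      using eq \<eta> by blast
    fix \<theta>' assume "\<theta>' \<in> coeff_vecs p (insert j A)"
    then obtain \<eta>' c where e: "\<eta>' \<in> coeff_vecs p A" "\<theta>' = \<eta>' + c \<cdot>\<^sub>v unit_vec p j"
      using j by (rule coeff_vecs_insert_split)
    have "X *\<^sub>v \<theta>' = X *\<^sub>v \<eta>' + c \<cdot>\<^sub>v col X j"
      using coeff_vecs_carrier[OF e(1)] X uc
      by (simp add: e(2) mult_add_distrib_mat_vec[OF X] mult_mat_vec[OF X] mult_mat_unit_vec[OF X j])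
    then show "(r - ?c \<cdot>\<^sub>v z) \<bullet> (X *\<^sub>v \<theta>') = 0"
      using orth[OF e(1)] orthj dc cj X_mult_carrier[OF e(1)]
      by (simp add: scalar_prod_add_distrib[of _ n] scalar_prod_smult_distrib[OF dc])
  qed
qed

text \<open>Gram-Schmidt by induction on \<open>A\<close>. The vector \<open>y\<close> is
  generalized because each step also needs the residual of the new column.\<close>

lemma is_resid_exists:
  assumes "A \<subseteq> {..<p}" "y \<in> carrier_vec n"
  shows "\<exists>r. is_resid X A y r"
proof -
  have "finite A" using assms(1) finite_subset by blast
  then show ?thesis using assms
  proof (induction A arbitrary: y rule: finite_induct)
    case empty
    then show ?case using is_resid_empty by blast
  next
    case (insert j A)
    have "col X j \<in> carrier_vec n" using X by (intro carrier_vecI) simp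
    then obtain r z where "is_resid X A y r" "is_resid X A (col X j) z"
      using insert by (metis insert_subset)
    then show ?case using is_resid_insert[of y j A r z] insert.prems by blast
  qed
qed

text \<open>The difference of two residuals lies in the span and is orthogonal to it, hence to
  itself.\<close>

lemma is_resid_unique:
  assumes y: "y \<in> carrier_vec n" and r: "is_resid X A y r" and s: "is_resid X A y s"
  shows "r = s"
proof -
  note rc = is_resid_carrier[OF r y] and sc = is_resid_carrier[OF s y]
  obtain \<theta> where \<theta>: "\<theta> \<in> coeff_vecs p A" "r = y - X *\<^sub>v \<theta>"
    using r by (auto simp: is_resid_def dim_X)
  obtain \<zeta> where \<zeta>: "\<zeta> \<in> coeff_vecs p A" "s = y - X *\<^sub>v \<zeta>"
    using s by (auto simp: is_resid_def dim_X)
  have m: "\<zeta> - \<theta> \<in> coeff_vecs p A" using \<theta> \<zeta> by (simp add: coeff_vecs_minus)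
  have d: "r - s = X *\<^sub>v (\<zeta> - \<theta>)"
    using y X_mult_carrier[OF \<theta>(1)] X_mult_carrier[OF \<zeta>(1)]
    unfolding mult_minus_distrib_mat_vec[OF X coeff_vecs_carrier[OF \<zeta>(1)] coeff_vecs_carrier[OF \<theta>(1)]]
    by (intro eq_vecI) (auto simp: \<theta>(2) \<zeta>(2))
  have "r \<bullet> (r - s) = 0" "s \<bullet> (r - s) = 0"
    using r s m unfolding d is_resid_def dim_X by blast+
  then have "sq_norm2 (r - s) = 0"
    using rc sc by (simp add: sq_norm2_def minus_scalar_prod_distrib[of _ n])
  then have "r - s = 0\<^sub>v n" using sq_norm2_eq_0_iff[of "r - s" n] rc sc by auto
  then have "(r - s) $ i = 0" if "i < n" for i using that by simp
  then show ?thesis using rc sc by (intro eq_vecI) auto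
qed

lemma is_resid_add:
  assumes y: "y \<in> carrier_vec n" "y' \<in> carrier_vec n"
    and r: "is_resid X A y r" and s: "is_resid X A y' s"
  shows "is_resid X A (y + y') (r + s)"
proof -
  note rc = is_resid_carrier[OF r y(1)] and sc = is_resid_carrier[OF s y(2)]
  obtain \<theta> where \<theta>: "\<theta> \<in> coeff_vecs p A" "r = y - X *\<^sub>v \<theta>"
    using r by (auto simp: is_resid_def dim_X)
  obtain \<zeta> where \<zeta>: "\<zeta> \<in> coeff_vecs p A" "s = y' - X *\<^sub>v \<zeta>"
    using s by (auto simp: is_resid_def dim_X)
  have "r + s = y + y' - X *\<^sub>v (\<theta> + \<zeta>)"
    using y X_mult_carrier[OF \<theta>(1)] X_mult_carrier[OF \<zeta>(1)]
    unfolding mult_add_distrib_mat_vec[OF X coeff_vecs_carrier[OF \<theta>(1)] coeff_vecs_carrier[OF \<zeta>(1)]]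
    by (intro eq_vecI) (auto simp: \<theta>(2) \<zeta>(2) dim_X dest!: carrier_vecD)
  moreover have "\<theta> + \<zeta> \<in> coeff_vecs p A" using \<theta> \<zeta> by (simp add: coeff_vecs_add)
  moreover have "(r + s) \<bullet> (X *\<^sub>v \<eta>) = 0" if "\<eta> \<in> coeff_vecs p A" for \<eta>
    using r s rc sc X_mult_carrier[OF that] that
    by (simp add: is_resid_def dim_X add_scalar_prod_distrib[of _ n])
  ultimately show ?thesis unfolding is_resid_def dim_X by blast
qed

text \<open>Vectors in the span are projected away. Applied to the true support, this eliminates the
  signal and leaves the residual of the noise alone.\<close>

lemma is_resid_shift:
  assumes y: "y \<in> carrier_vec n" and r: "is_resid X A y r" and \<theta>: "\<theta> \<in> coeff_vecs p A"
  shows "is_resid X A (X *\<^sub>v \<theta> + y) r"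
proof -
  obtain \<zeta> where \<zeta>: "\<zeta> \<in> coeff_vecs p A" "r = y - X *\<^sub>v \<zeta>"
    using r by (auto simp: is_resid_def dim_X)
  have "r = X *\<^sub>v \<theta> + y - X *\<^sub>v (\<theta> + \<zeta>)"
    using y X_mult_carrier[OF \<theta>(1)] X_mult_carrier[OF \<zeta>(1)]
    unfolding mult_add_distrib_mat_vec[OF X coeff_vecs_carrier[OF \<theta>(1)] coeff_vecs_carrier[OF \<zeta>(1)]]
    by (intro eq_vecI) (auto simp: \<zeta>(2) dim_X dest!: carrier_vecD)
  moreover have "\<theta> + \<zeta> \<in> coeff_vecs p A" using \<theta> \<zeta> by (simp add: coeff_vecs_add)
  ultimately show ?thesis using r by (auto simp: is_resid_def dim_X)
qed

text \<open>\<open>s\<close> and \<open>w\<close> differ by a vector in the span, to which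
  \<open>r\<close> is orthogonal.\<close>

lemma is_resid_dot:
  assumes y: "y \<in> carrier_vec n" and w: "w \<in> carrier_vec n"
    and r: "is_resid X A y r" and s: "is_resid X A w s"
  shows "r \<bullet> s = r \<bullet> w"
proof -
  obtain \<zeta> where \<zeta>: "\<zeta> \<in> coeff_vecs p A" "s = w - X *\<^sub>v \<zeta>"
    using s by (auto simp: is_resid_def dim_X)
  then show ?thesis
    using r w X_mult_carrier[OF \<zeta>(1)] is_resid_carrier[OF r y]
    by (simp add: is_resid_def dim_X scalar_prod_minus_distrib[of _ n])
qed

text \<open>Pythagoras: any other candidate differs from \<open>r\<close> by a vector
  \<open>d\<close> of the span, and \<open>r\<close> is orthogonal to \<open>d\<close>.\<close>

lemma is_resid_minimal:
  assumes y: "y \<in> carrier_vec n" and r: "is_resid X A y r" and \<theta>: "\<theta> \<in> coeff_vecs p A"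
  shows "sq_norm2 r \<le> sq_norm2 (y - X *\<^sub>v \<theta>)"
proof -
  obtain \<zeta> where \<zeta>: "\<zeta> \<in> coeff_vecs p A" "r = y - X *\<^sub>v \<zeta>"
    using r by (auto simp: is_resid_def dim_X)
  note rc = is_resid_carrier[OF r y]
  define d where "d = X *\<^sub>v (\<zeta> - \<theta>)"
  have m: "\<zeta> - \<theta> \<in> coeff_vecs p A" using \<theta> \<zeta> by (simp add: coeff_vecs_minus)
  have dc: "d \<in> carrier_vec n" unfolding d_def by (rule X_mult_carrier[OF m])
  have "y - X *\<^sub>v \<theta> = r + d"
    using y X_mult_carrier[OF \<theta>(1)] X_mult_carrier[OF \<zeta>(1)] unfolding d_def
    unfolding mult_minus_distrib_mat_vec[OF X coeff_vecs_carrier[OF \<zeta>(1)] coeff_vecs_carrier[OF \<theta>(1)]]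
    by (intro eq_vecI) (auto simp: \<zeta>(2))
  moreover have "r \<bullet> d = 0" using r m unfolding is_resid_def dim_X d_def by blast
  ultimately have "sq_norm2 (y - X *\<^sub>v \<theta>) = sq_norm2 r + sq_norm2 d"
    using rc dc comm_scalar_prod[OF rc dc]
    by (simp add: sq_norm2_def add_scalar_prod_distrib[of _ n] scalar_prod_add_distrib[of _ n])
  then show ?thesis using sq_norm2_nonneg[of d] by linarith
qed

section \<open>From submatrices to full-length coefficient vectors\<close>

lemma submatrix_columns_mult:
  assumes S: "S \<subseteq> {..<p}" and \<theta>: "\<theta> \<in> coeff_vecs p S"
  shows "submatrix X UNIV S *\<^sub>v vec (card S) (\<lambda>a. \<theta> $ pick S a) = X *\<^sub>v \<theta>"
proof (rule eq_vecI)
  have S': "{j. j < p \<and> j \<in> S} = S" using S by auto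
  have fS: "finite S" using S finite_subset by blast
  have sub: "submatrix X UNIV S = mat n (card S) (\<lambda>(i, a). X $$ (i, pick S a))"
    by (simp add: submatrix_def dim_X S' pick_UNIV)
  \<comment> \<open>\<open>pick S\<close> enumerates \<open>S\<close> in increasing order; its
    inverse counts the elements of \<open>S\<close> below a given one.\<close>
  have "bij_betw (pick S) {0..<card S} S"
    by (rule bij_betwI[where g = "\<lambda>i. card {a \<in> S. a < i}"])
      (auto simp: pick_in_set_le card_pick_le pick_card_in_set
        intro!: psubset_card_mono[OF fS])
  note reindex = sum.reindex_bij_betw[OF this]
  fix i assume "i < dim_vec (X *\<^sub>v \<theta>)"
  then have i: "i < n" by (simp add: dim_X)
  have "(X *\<^sub>v \<theta>) $ i = (\<Sum>j\<in>{0..<p}. X $$ (i, j) * \<theta> $ j)"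
    using i \<theta> by (auto simp: scalar_prod_def dim_X coeff_vecs_iff intro!: sum.cong)
  also have "\<dots> = (\<Sum>j\<in>S. X $$ (i, j) * \<theta> $ j)"
    using S \<theta> by (intro sum.mono_neutral_right) (auto simp: coeff_vecs_iff)
  also have "\<dots> = (\<Sum>a\<in>{0..<card S}. X $$ (i, pick S a) * \<theta> $ pick S a)"
    by (rule reindex[symmetric])
  finally show "(submatrix X UNIV S *\<^sub>v vec (card S) (\<lambda>a. \<theta> $ pick S a)) $ i = (X *\<^sub>v \<theta>) $ i"
    using i by (simp add: sub scalar_prod_def)
qed (use X in \<open>simp add: submatrix_def\<close>)

lemma submatrix_columns_mult_ex:
  assumes S: "S \<subseteq> {..<p}" and \<alpha>: "\<alpha> \<in> carrier_vec (card S)"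
  shows "\<exists>\<theta>\<in>coeff_vecs p S. submatrix X UNIV S *\<^sub>v \<alpha> = X *\<^sub>v \<theta>"
proof
  let ?\<theta> = "vec p (\<lambda>j. if j \<in> S then \<alpha> $ card {a \<in> S. a < j} else 0)"
  show \<theta>: "?\<theta> \<in> coeff_vecs p S" by (simp add: coeff_vecs_iff)
  have "?\<theta> $ pick S a = \<alpha> $ a" if "a < card S" for a
    using that S pick_in_set_le[OF that] by (auto simp: card_pick_le)
  then have "vec (card S) (\<lambda>a. ?\<theta> $ pick S a) = \<alpha>"
    using \<alpha> by (intro eq_vecI) auto
  then show "submatrix X UNIV S *\<^sub>v \<alpha> = X *\<^sub>v ?\<theta>"
    using submatrix_columns_mult[OF S \<theta>] by simp
qed

text \<open>The two preceding lemmas identify the candidates in \<open>loss\<close> with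
  \<open>X *\<^sub>v \<theta>\<close> for \<open>\<theta>\<close> supported in \<open>S\<close>, so
  the residual attains the infimum.\<close>

lemma loss_eq_resid:
  assumes S: "S \<subseteq> {..<p}" and y: "y \<in> carrier_vec n" and r: "is_resid X S y r"
  shows "loss y X S = sq_norm2 r"
  unfolding loss_def
proof (rule cInf_eq_minimum)
  obtain \<theta> where \<theta>: "\<theta> \<in> coeff_vecs p S" "r = y - X *\<^sub>v \<theta>"
    using r by (auto simp: is_resid_def dim_X)
  with submatrix_columns_mult[OF S \<theta>(1)]
  show "sq_norm2 r \<in> (\<lambda>\<alpha>. sq_norm2 (y - submatrix X UNIV S *\<^sub>v \<alpha>)) ` carrier_vec (card S)"
    by (intro image_eqI[of _ _ "vec (card S) (\<lambda>a. \<theta> $ pick S a)"]) auto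
  show "sq_norm2 r \<le> x"
    if "x \<in> (\<lambda>\<alpha>. sq_norm2 (y - submatrix X UNIV S *\<^sub>v \<alpha>)) ` carrier_vec (card S)" for x
    using that submatrix_columns_mult_ex[OF S] is_resid_minimal[OF y r] by force
qed

section \<open>Decrease of the squared residual when columns are added\<close>

text \<open>\<open>u\<close> is the normalized component of column \<open>j\<close> orthogonal to
  the columns in \<open>A\<close>. It is chosen before \<open>w\<close>, so for random
  \<open>w\<close> it is a fixed direction to which tail bounds apply.\<close>

lemma resid_rank_one_update:
  assumes A: "A \<subseteq> {..<p}" and j: "j < p"
  shows "\<exists>u\<in>carrier_vec n. sq_norm2 u \<le> 1 \<and>
    (\<forall>w r r'. w \<in> carrier_vec n \<longrightarrow> is_resid X A w r \<longrightarrow> is_resid X (insert j A) w r' \<longrightarrow>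
      sq_norm2 r' = sq_norm2 r - (u \<bullet> w)\<^sup>2)"
proof -
  have cj: "col X j \<in> carrier_vec n" using X by (intro carrier_vecI) simp
  obtain z where z: "is_resid X A (col X j) z" using is_resid_exists[OF A cj] by blast
  note zc = is_resid_carrier[OF z cj]
  \<comment> \<open>For \<open>z = 0\<close> this is 0 by the convention for division, so
    \<open>u\<close> is then zero; hence the bound \<open>sq_norm2 u \<le> 1\<close> instead of an
    equality.\<close>
  define a where "a = 1 / sqrt (z \<bullet> z)"
  have zz: "z \<bullet> z \<ge> 0" using sq_norm2_nonneg[of z] by (simp add: sq_norm2_def)
  have a2: "a\<^sup>2 = 1 / (z \<bullet> z)" using zz by (simp add: a_def power_divide)
  have uc: "a \<cdot>\<^sub>v z \<in> carrier_vec n" using zc by simp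
  have "sq_norm2 (a \<cdot>\<^sub>v z) = a\<^sup>2 * (z \<bullet> z)"
    using zc by (simp add: sq_norm2_def power2_eq_square)
  then have u1: "sq_norm2 (a \<cdot>\<^sub>v z) \<le> 1" using a2 by simp
  moreover have "sq_norm2 r' = sq_norm2 r - ((a \<cdot>\<^sub>v z) \<bullet> w)\<^sup>2"
    if w: "w \<in> carrier_vec n" and r: "is_resid X A w r" and r': "is_resid X (insert j A) w r'" for w r r'
  proof -
    note rc = is_resid_carrier[OF r w]
    let ?c = "(r \<bullet> z) / (z \<bullet> z)"
    have eq: "r' = r - ?c \<cdot>\<^sub>v z"
      using is_resid_unique[OF w r' is_resid_insert[OF w j r z]] .
    \<comment> \<open>Since \<open>z\<close> is itself a residual for \<open>A\<close>, it sees only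
      the residual part \<open>r\<close> of \<open>w\<close>.\<close>
    have rz: "z \<bullet> w = r \<bullet> z" using is_resid_dot[OF cj w z r] comm_scalar_prod[OF rc zc] by simp
    have "sq_norm2 r' = r \<bullet> r - 2 * ?c * (r \<bullet> z) + ?c\<^sup>2 * (z \<bullet> z)"
      using rc zc comm_scalar_prod[OF rc zc] unfolding sq_norm2_def eq
      by (simp add: minus_scalar_prod_distrib[of _ n] scalar_prod_minus_distrib[of _ n]
          algebra_simps power2_eq_square)
    also have "\<dots> = r \<bullet> r - (r \<bullet> z)\<^sup>2 / (z \<bullet> z)"
      by (cases "z \<bullet> z = 0") (auto simp: field_simps power2_eq_square)
    also have "(r \<bullet> z)\<^sup>2 / (z \<bullet> z) = ((a \<cdot>\<^sub>v z) \<bullet> w)\<^sup>2"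
      using zc w by (simp add: power_mult_distrib a2 rz)
    finally show ?thesis by (simp add: sq_norm2_def)
  qed
  ultimately show ?thesis using uc by blast
qed

lemma resid_update:
  assumes A: "A \<subseteq> {..<p}" and B: "B \<subseteq> {..<p}"
  shows "\<exists>u. (\<forall>b\<in>B. u b \<in> carrier_vec n \<and> sq_norm2 (u b) \<le> 1) \<and>
    (\<forall>w r r'. w \<in> carrier_vec n \<longrightarrow> is_resid X A w r \<longrightarrow> is_resid X (A \<union> B) w r' \<longrightarrow>
      sq_norm2 r' = sq_norm2 r - (\<Sum>b\<in>B. (u b \<bullet> w)\<^sup>2))"
proof -
  have "finite B" using B finite_subset by blast
  then show ?thesis using B
  proof (induction B rule: finite_induct)
    case empty
    have "sq_norm2 r' = sq_norm2 r"
      if "w \<in> carrier_vec n" "is_resid X A w r" "is_resid X A w r'" for w r r'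
      using is_resid_unique[OF that] by simp
    then show ?case unfolding Un_empty_right sum.empty diff_0_right by blast
  next
    case (insert j B)
    then obtain u where u: "\<And>b. b \<in> B \<Longrightarrow> u b \<in> carrier_vec n \<and> sq_norm2 (u b) \<le> 1"
      and upd: "\<And>w r r'. w \<in> carrier_vec n \<Longrightarrow> is_resid X A w r \<Longrightarrow> is_resid X (A \<union> B) w r' \<Longrightarrow>
        sq_norm2 r' = sq_norm2 r - (\<Sum>b\<in>B. (u b \<bullet> w)\<^sup>2)"
      by blast
    have AB: "A \<union> B \<subseteq> {..<p}" and j: "j < p" using A insert.prems by auto
    obtain v where v: "v \<in> carrier_vec n" "sq_norm2 v \<le> 1"
      and vupd: "\<And>w r r'. w \<in> carrier_vec n \<Longrightarrow> is_resid X (A \<union> B) w r \<Longrightarrow>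
        is_resid X (insert j (A \<union> B)) w r' \<Longrightarrow> sq_norm2 r' = sq_norm2 r - (v \<bullet> w)\<^sup>2"
      using resid_rank_one_update[OF AB j] by blast
    show ?case
    proof (intro exI[of _ "u(j := v)"] conjI ballI allI impI)
      fix w r r' assume w: "w \<in> carrier_vec n" and r: "is_resid X A w r"
        and r': "is_resid X (A \<union> insert j B) w r'"
      obtain q where q: "is_resid X (A \<union> B) w q" using is_resid_exists[OF AB w] by blast
      have "(\<Sum>b\<in>B. ((u(j := v)) b \<bullet> w)\<^sup>2) = (\<Sum>b\<in>B. (u b \<bullet> w)\<^sup>2)"
        using insert.hyps by (intro sum.cong) auto
      then show "sq_norm2 r' = sq_norm2 r - (\<Sum>b\<in>insert j B. ((u(j := v)) b \<bullet> w)\<^sup>2)"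
        using upd[OF w r q] vupd[OF w q] r' insert.hyps by simp
    qed (use u v in auto)
  qed
qed

text \<open>The loss at the true support involves only the noise, and the one at \<open>S\<close> is
  the squared length of \<open>v\<close> plus the noise residual on \<open>S\<close>. Both noise
  residuals are compared with the one on \<open>S \<inter> support \<beta>\<close>, from which
  \<open>S\<close> is reached by adding the columns in \<open>S - support \<beta>\<close>.\<close>

lemma loss_gap:
  assumes \<beta>: "\<beta> \<in> carrier_vec p" and S: "S \<subseteq> {..<p}"
    and v: "is_resid X S (X *\<^sub>v \<beta>) v"
  shows "\<exists>u. (\<forall>b\<in>S - support \<beta>. u b \<in> carrier_vec n \<and> sq_norm2 (u b) \<le> 1) \<and>
    (\<forall>w\<in>carrier_vec n. loss (X *\<^sub>v \<beta> + w) X (support \<beta>) + sq_norm2 v + 2 * (v \<bullet> w)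
      - (\<Sum>b\<in>S - support \<beta>. (u b \<bullet> w)\<^sup>2) \<le> loss (X *\<^sub>v \<beta> + w) X S)"
proof -
  let ?A = "S \<inter> support \<beta>" and ?B = "S - support \<beta>"
  have supp: "support \<beta> \<subseteq> {..<p}" using \<beta> by (auto simp: support_def)
  have A: "?A \<subseteq> {..<p}" "?B \<subseteq> {..<p}" using S by auto
  have Xb: "X *\<^sub>v \<beta> \<in> carrier_vec n" using X \<beta> by simp
  have bc: "\<beta> \<in> coeff_vecs p (support \<beta>)" using \<beta> by (simp add: coeff_vecs_def)
  have AB: "?A \<union> ?B = S" by blast
  obtain u where u: "\<forall>b\<in>?B. u b \<in> carrier_vec n \<and> sq_norm2 (u b) \<le> 1"
    and upd: "\<And>w r r'. w \<in> carrier_vec n \<Longrightarrow> is_resid X ?A w r \<Longrightarrow> is_resid X S w r' \<Longrightarrow>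
        sq_norm2 r' = sq_norm2 r - (\<Sum>b\<in>?B. (u b \<bullet> w)\<^sup>2)"
    using resid_update[OF A] unfolding AB by blast
  have "loss (X *\<^sub>v \<beta> + w) X (support \<beta>) + sq_norm2 v + 2 * (v \<bullet> w)
      - (\<Sum>b\<in>?B. (u b \<bullet> w)\<^sup>2) \<le> loss (X *\<^sub>v \<beta> + w) X S" if w: "w \<in> carrier_vec n" for w
  proof -
    obtain a s t where a: "is_resid X ?A w a" and s: "is_resid X S w s"
      and t: "is_resid X (support \<beta>) w t"
      using is_resid_exists[OF A(1) w] is_resid_exists[OF S w] is_resid_exists[OF supp w] by blast
    have yc: "X *\<^sub>v \<beta> + w \<in> carrier_vec n" using Xb w by simp
    have "loss (X *\<^sub>v \<beta> + w) X (support \<beta>) = sq_norm2 t"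
      using loss_eq_resid[OF supp yc is_resid_shift[OF w t bc]] .
    \<comment> \<open>Projecting onto fewer columns leaves a residual that is at least as
      long.\<close>
    also have "\<dots> \<le> sq_norm2 a"
    proof -
      obtain \<theta> where "\<theta> \<in> coeff_vecs p ?A" "a = w - X *\<^sub>v \<theta>"
        using a by (auto simp: is_resid_def dim_X)
      then show ?thesis using is_resid_minimal[OF w t] coeff_vecs_mono[of \<theta> p ?A "support \<beta>"] by auto
    qed
    finally have 1: "loss (X *\<^sub>v \<beta> + w) X (support \<beta>) \<le> sq_norm2 a" .
    have "loss (X *\<^sub>v \<beta> + w) X S = sq_norm2 (v + s)"
      by (rule loss_eq_resid[OF S yc is_resid_add[OF Xb w v s]])
    also have "\<dots> = sq_norm2 v + 2 * (v \<bullet> s) + sq_norm2 s"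
      using is_resid_carrier[OF v Xb] is_resid_carrier[OF s w]
        comm_scalar_prod[OF is_resid_carrier[OF v Xb] is_resid_carrier[OF s w]]
      by (simp add: sq_norm2_def add_scalar_prod_distrib[of _ n] scalar_prod_add_distrib[of _ n])
    also have "v \<bullet> s = v \<bullet> w" by (rule is_resid_dot[OF Xb w v s])
    finally show ?thesis using 1 upd[OF w a s] by simp
  qed
  with u show ?thesis by blast
qed

end

subsection \<open>Signal strength, exchanges and sets near the true support\<close>

lemma rho_le:
  assumes X: "X \<in> carrier_mat n p" and \<theta>: "\<theta> \<in> carrier_vec p"
    and m: "card (support \<theta>) \<le> m" and S: "S \<subseteq> support \<theta>"
  shows "rho X S m * (real n * sq_norm2 \<theta>) \<le> sq_norm2 (X *\<^sub>v \<theta>)"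
proof (cases "real n * sq_norm2 \<theta> = 0")
  case True
  show ?thesis unfolding True using sq_norm2_nonneg[of "X *\<^sub>v \<theta>"] by simp
next
  case False
  then have pos: "0 < real n * sq_norm2 \<theta>"
    using sq_norm2_nonneg[of \<theta>] by (metis mult_nonneg_nonneg of_nat_0_le_iff order_le_less)
  have dims: "dim_row X = n" "dim_col X = p" using X by auto
  have "rho X S m \<le> sq_norm2 (X *\<^sub>v \<theta>) / (real n * sq_norm2 \<theta>)"
    unfolding rho_def dims
  proof (rule cInf_lower)
    show "bdd_below {sq_norm2 (X *\<^sub>v \<theta>) / (real n * sq_norm2 \<theta>) |\<theta>.
       \<theta> \<in> carrier_vec p \<and> card (support \<theta>) \<le> m \<and> S \<subseteq> support \<theta>}"
      by (rule bdd_belowI[of _ 0]) (auto simp: sq_norm2_nonneg)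
  qed (use assms in blast)
  then show ?thesis using pos by (simp add: pos_le_divide_eq)
qed

text \<open>Coefficient vectors whose support is not all of \<open>T\<close> are reached as limits of vectors
  with support exactly \<open>T\<close>; \<^const>\<open>rho\<close> itself only ranges over vectors whose support
  contains \<open>S\<close>.\<close>

lemma rho_le_supported:
  assumes X: "X \<in> carrier_mat n p" and \<phi>: "\<phi> \<in> coeff_vecs p T"
    and T: "T \<subseteq> {..<p}" "card T \<le> m" "S \<subseteq> T" and rho: "0 \<le> rho X S m"
  shows "rho X S m * (real n * sq_norm2 \<phi>) \<le> sq_norm2 (X *\<^sub>v \<phi>)"
proof -
  \<comment> \<open>\<open>e\<close> fills exactly the coordinates of \<open>T\<close> where
    \<open>\<phi>\<close> vanishes. It is orthogonal to \<open>\<phi>\<close>, so adding a multiple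
    of it cannot shorten \<open>\<phi>\<close>.\<close>
  define e where "e = vec p (\<lambda>i. if i \<in> T \<and> \<phi> $ i = 0 then 1 else 0 :: real)"
  have ec: "e \<in> carrier_vec p" by (simp add: e_def)
  note \<phi>c = coeff_vecs_carrier[OF \<phi>]
  have \<phi>e: "\<phi> \<bullet> e = 0" unfolding scalar_prod_def by (intro sum.neutral) (auto simp: e_def)
  have Xc: "X *\<^sub>v \<phi> \<in> carrier_vec n" "X *\<^sub>v e \<in> carrier_vec n" using X \<phi>c ec by auto
  let ?a = "(X *\<^sub>v \<phi>) \<bullet> (X *\<^sub>v e)" and ?b = "sq_norm2 (X *\<^sub>v e)"
  have le: "rho X S m * (real n * sq_norm2 \<phi>) \<le> sq_norm2 (X *\<^sub>v \<phi>) + 2 * t * ?a + t\<^sup>2 * ?b"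
    if t: "t > 0" for t
  proof -
    let ?\<theta> = "\<phi> + t \<cdot>\<^sub>v e"
    have \<theta>c: "?\<theta> \<in> carrier_vec p" using \<phi>c ec by simp
    have Tp: "i < p" if "i \<in> T" for i using that T(1) by auto
    have "?\<theta> $ i \<noteq> 0 \<longleftrightarrow> i \<in> T" if "i < p" for i
      using that \<phi> t by (auto simp: e_def coeff_vecs_iff)
    then have "support ?\<theta> = T"
      using Tp unfolding support_def carrier_vecD[OF \<theta>c] by blast
    then have "rho X S m * (real n * sq_norm2 ?\<theta>) \<le> sq_norm2 (X *\<^sub>v ?\<theta>)"
      using T by (intro rho_le[OF X \<theta>c]) auto
    moreover have "sq_norm2 ?\<theta> = sq_norm2 \<phi> + t\<^sup>2 * sq_norm2 e"
      using \<phi>c ec \<phi>e comm_scalar_prod[OF \<phi>c ec]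
      by (simp add: sq_norm2_def add_scalar_prod_distrib[of _ p] scalar_prod_add_distrib[of _ p]
          power2_eq_square)
    then have "rho X S m * (real n * sq_norm2 \<phi>) \<le> rho X S m * (real n * sq_norm2 ?\<theta>)"
      using rho sq_norm2_nonneg[of e] by (intro mult_left_mono) auto
    moreover have "X *\<^sub>v ?\<theta> = X *\<^sub>v \<phi> + t \<cdot>\<^sub>v (X *\<^sub>v e)"
      using \<phi>c ec by (simp add: mult_add_distrib_mat_vec[OF X] mult_mat_vec[OF X])
    then have "sq_norm2 (X *\<^sub>v ?\<theta>) = sq_norm2 (X *\<^sub>v \<phi>) + 2 * t * ?a + t\<^sup>2 * ?b"
      using Xc comm_scalar_prod[OF Xc]
      by (simp add: sq_norm2_def add_scalar_prod_distrib[of _ n] scalar_prod_add_distrib[of _ n]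
          power2_eq_square distrib_left)
    ultimately show ?thesis by linarith
  qed
  \<comment> \<open>The left side of \<open>le\<close> does not depend on \<open>t\<close>, so the
    bound survives the limit from the right at 0.\<close>
  have "((\<lambda>t. sq_norm2 (X *\<^sub>v \<phi>) + 2 * t * ?a + t\<^sup>2 * ?b) \<longlongrightarrow> 
      sq_norm2 (X *\<^sub>v \<phi>) + 2 * 0 * ?a + 0\<^sup>2 * ?b) (at_right 0)"
    by (intro tendsto_intros)
  then have "rho X S m * (real n * sq_norm2 \<phi>) \<le> sq_norm2 (X *\<^sub>v \<phi>) + 2 * 0 * ?a + 0\<^sup>2 * ?b"
    by (rule tendsto_lowerbound) (auto intro!: eventually_mono[OF eventually_at_right_less le])
  then show ?thesis by simp
qed

lemma sq_norm2_ge_beta_min: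
  assumes "\<phi> \<in> carrier_vec p" "\<beta> \<in> carrier_vec p" "D \<subseteq> support \<beta>"
    and eq: "\<And>i. i \<in> D \<Longrightarrow> \<phi> $ i = \<beta> $ i"
  shows "real (card D) * (beta_min \<beta>)\<^sup>2 \<le> sq_norm2 \<phi>"
proof -
  have supp: "support \<beta> \<subseteq> {0..<p}" "finite (support \<beta>)"
    using assms(2) by (auto simp: support_def)
  have "(beta_min \<beta>)\<^sup>2 \<le> (\<phi> $ i)\<^sup>2" if "i \<in> D" for i
  proof -
    have i: "i \<in> support \<beta>" using that assms(3) by blast
    have "beta_min \<beta> \<le> \<bar>\<beta> $ i\<bar>" "0 \<le> beta_min \<beta>"
      using i supp unfolding beta_min_def by (auto intro!: Min.boundedI)
    then show ?thesis using eq[OF that] by (metis abs_of_nonneg abs_le_square_iff)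
  qed
  then have "real (card D) * (beta_min \<beta>)\<^sup>2 \<le> (\<Sum>i\<in>D. (\<phi> $ i)\<^sup>2)"
    using sum_mono[of D "\<lambda>_. (beta_min \<beta>)\<^sup>2" "\<lambda>i. (\<phi> $ i)\<^sup>2"] by simp
  also have "\<dots> \<le> (\<Sum>i\<in>{0..<p}. (\<phi> $ i)\<^sup>2)"
    using assms(3) supp by (intro sum_mono2) auto
  also have "\<dots> = sq_norm2 \<phi>"
    using assms(1) by (simp add: sq_norm2_def scalar_prod_def power2_eq_square)
  finally show ?thesis .
qed

text \<open>The residual is \<open>X *\<^sub>v (\<beta> - \<theta>)\<close> with
  \<open>\<theta>\<close> zero outside \<open>S\<close>. So \<open>\<beta> - \<theta>\<close> agrees
  with \<open>\<beta>\<close> on the missed coordinates, each of size at least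
  \<open>beta_min \<beta>\<close>, and is supported in
  \<open>S \<union> support \<beta>\<close>.\<close>

lemma signal_lower_bound:
  assumes X: "X \<in> carrier_mat n p" and \<beta>: "\<beta> \<in> carrier_vec p" and S: "S \<subseteq> {..<p}"
    and v: "is_resid X S (X *\<^sub>v \<beta>) v"
    and m: "card (S \<union> support \<beta>) \<le> m" and rho: "0 \<le> rho X (support \<beta>) m"
  shows "rho X (support \<beta>) m * (real n * (real (card (support \<beta> - S)) * (beta_min \<beta>)\<^sup>2)) \<le> sq_norm2 v"
proof -
  have dimX: "dim_col X = p" using X by auto
  obtain \<theta> where \<theta>: "\<theta> \<in> coeff_vecs p S" "v = X *\<^sub>v \<beta> - X *\<^sub>v \<theta>"
    using v by (auto simp: is_resid_def dimX)
  have \<beta>': "\<beta> \<in> coeff_vecs p (support \<beta>)" using \<beta> by (simp add: coeff_vecs_def)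
  have \<phi>: "\<beta> - \<theta> \<in> coeff_vecs p (S \<union> support \<beta>)"
    by (intro coeff_vecs_minus coeff_vecs_mono[OF \<beta>'] coeff_vecs_mono[OF \<theta>(1)]) auto
  have v_eq: "v = X *\<^sub>v (\<beta> - \<theta>)"
    using mult_minus_distrib_mat_vec[OF X \<beta> coeff_vecs_carrier[OF \<theta>(1)]] \<theta>(2) by simp
  have "real (card (support \<beta> - S)) * (beta_min \<beta>)\<^sup>2 \<le> sq_norm2 (\<beta> - \<theta>)"
    using \<theta>(1) \<beta> by (intro sq_norm2_ge_beta_min[OF coeff_vecs_carrier[OF \<phi>] \<beta>])
      (auto simp: coeff_vecs_iff support_def)
  then have "rho X (support \<beta>) m * (real n * (real (card (support \<beta> - S)) * (beta_min \<beta>)\<^sup>2))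
      \<le> rho X (support \<beta>) m * (real n * sq_norm2 (\<beta> - \<theta>))"
    using rho by (intro mult_left_mono) auto
  also have "\<dots> \<le> sq_norm2 v"
    unfolding v_eq using S \<beta> m rho
    by (intro rho_le_supported[OF X \<phi>]) (auto simp: support_def)
  finally show ?thesis .
qed

section \<open>Deterministic behaviour of SWAP near the true support\<close>

text \<open>From a set missing one element of \<open>T\<close>, some exchange yields
  \<open>T\<close>, so the best exchange has loss at most that of \<open>T\<close>. That exchange
  misses at most two elements, and the gap excludes one or two.\<close>

lemma swap_output_eq_strict_minimizer:
  assumes "swap_output y X S R"
    and T: "T \<subseteq> {..<dim_col X}"
    and gap: "\<And>S. S \<subseteq> {..<dim_col X} \<Longrightarrow> card S = card T \<Longrightarrow> card (T - S) \<in> {1, 2} \<Longrightarrow>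
      loss y X T < loss y X S"
    and "S \<subseteq> {..<dim_col X}" "card S = card T" "card (T - S) \<le> 1"
  shows "R = T"
proof -
  have fT: "finite T" using T finite_subset by blast
  have eqI: "S = T" if "S \<subseteq> {..<dim_col X}" "card S = card T" "card (T - S) = 0" for S
  proof -
    have "T \<subseteq> S" using that(3) fT by auto
    then show ?thesis using that(1,2) card_subset_eq[of S T] finite_subset by auto
  qed
  have swap_back: "\<exists>q\<in>exchange_pairs X S. exchange S q = T"
    if S: "S \<subseteq> {..<dim_col X}" "card S = card T" "card (T - S) = 1" for S
  proof -
    have fS: "finite S" using S finite_subset by blast
    obtain i' where i': "T - S = {i'}" using S(3) by (auto simp: card_1_singleton_iff)
    have "card (S - T) = card (T - S)"
      using S(2) fS fT by (simp add: card_Diff_subset_Int Int_commute)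
    then obtain i where i: "S - T = {i}" using S(3) by (auto simp: card_1_singleton_iff)
    have "(i, i') \<in> exchange_pairs X S" "exchange S (i, i') = T"
      using i i' T by (auto simp: exchange_pairs_def exchange_def)
    then show ?thesis by blast
  qed
  show ?thesis
    using assms(1,4-)
  proof (induction rule: swap_output.induct)
    case (stop S)
    show ?case
    proof (cases "card (T - S) = 0")
      case True
      then show ?thesis using eqI stop by blast
    next
      case False
      \<comment> \<open>SWAP cannot stop here: the exchange leading to \<open>T\<close> would lower
        the loss.\<close>
      then have 1: "card (T - S) = 1" using stop by linarith
      then obtain q where "q \<in> exchange_pairs X S" "exchange S q = T" using swap_back stop by blast
      then show ?thesis using stop.hyps gap[of S] stop.prems 1 by fastforce
    qed
  next
    case (step S q R)
    have fS: "finite S" using step.prems finite_subset by blast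
    have q: "q \<in> exchange_pairs X S"
      and qmin: "\<And>r. r \<in> exchange_pairs X S \<Longrightarrow> loss y X (exchange S q) \<le> loss y X (exchange S r)"
      using step.hyps(1) by (auto simp: is_arg_min_linorder)
    let ?E = "exchange S q"
    obtain i i' where ii: "q = (i, i')" "i \<in> S" "i' \<notin> S" "i' < dim_col X"
      using q by (auto simp: exchange_pairs_def)
    have "card (insert i' (S - {i})) = card S"
      using ii(2,3) fS by (metis card_Suc_Diff1 card_insert_disjoint DiffD1 finite_Diff)
    then have E: "?E \<subseteq> {..<dim_col X}" "card ?E = card T"
      using ii step.prems by (auto simp: exchange_def)
    \<comment> \<open>Only the removed element \<open>i\<close> can be newly missed.\<close>
    have "T - ?E \<subseteq> insert i (T - S)" using ii by (auto simp: exchange_def)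
    then have "card (T - ?E) \<le> card (insert i (T - S))" using fT by (intro card_mono) auto
    also have "\<dots> \<le> 2"
      using step.prems(3) by (intro card_insert_le_m1) auto
    finally have le2: "card (T - ?E) \<le> 2" .
    \<comment> \<open>If \<open>S = T\<close>, this is the strict decrease required for a step;
      otherwise it is minimality of \<open>q\<close> against the exchange leading to
      \<open>T\<close>.\<close>
    have "loss y X ?E \<le> loss y X T"
    proof (cases "card (T - S) = 0")
      case True
      then show ?thesis using eqI[of S] step by simp
    next
      case False
      then have "card (T - S) = 1" using step by linarith
      then show ?thesis using swap_back[of S] step.prems qmin by fastforce
    qed
    then have "card (T - ?E) \<notin> {1, 2}" using gap[OF E] by fastforce
    then have "card (T - ?E) = 0" using le2 by auto
    then show ?case using step.IH E by simp
  qed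
qed

section \<open>Counting supports at a given distance\<close>

text \<open>Given \<open>T\<close>, the set \<open>S\<close> is determined by \<open>T - S\<close>
  and \<open>S - T\<close>, both of size \<open>l\<close>; each binomial coefficient is at most the
  corresponding power.\<close>

lemma card_sets_at_distance_le:
  assumes U: "finite U" and T: "T \<subseteq> U"
  shows "card {S. S \<subseteq> U \<and> card S = card T \<and> card (T - S) = l} \<le> (card T * (card U - card T)) ^ l"
    (is "card ?\<C> \<le> _")
proof -
  have fT: "finite T" using assms finite_subset by blast
  let ?P = "{B. B \<subseteq> T \<and> card B = l}" and ?Q = "{B. B \<subseteq> U - T \<and> card B = l}"
  let ?f = "\<lambda>S. (T - S, S - T)"
  have choose: "m choose l \<le> m ^ l" for m :: nat
    using binomial_le_pow[of l m] by (cases "l \<le> m") (auto simp: binomial_eq_0)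
  have "inj_on ?f ?\<C>" by (rule inj_onI) blast
  moreover have "?f ` ?\<C> \<subseteq> ?P \<times> ?Q"
  proof safe
    fix S assume S: "S \<subseteq> U" "card S = card T" "l = card (T - S)"
    then have "finite S" using U finite_subset by blast
    then show "card (S - T) = card (T - S)"
      using S fT by (simp add: card_Diff_subset_Int Int_commute)
  qed (use T in auto)
  ultimately have "card ?\<C> \<le> card (?P \<times> ?Q)"
    using U fT by (intro card_inj_on_le[of ?f]) auto
  also have "\<dots> = (card T choose l) * ((card U - card T) choose l)"
    using n_subsets[OF fT, of l] n_subsets[of "U - T" l] U fT T
    by (simp add: card_cartesian_product card_Diff_subset)
  also have "\<dots> \<le> card T ^ l * (card U - card T) ^ l"
    using choose by (intro mult_mono) auto
  finally show ?thesis by (simp add: power_mult_distrib)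
qed

subsection \<open>Tail bounds and recovery probability\<close>

context sparse_regression
begin

section \<open>Linear functionals of the noise\<close>

lemma noise_measurable [measurable]:
  "j < n \<Longrightarrow> (\<lambda>\<omega>. w \<omega> $ j) \<in> borel_measurable M"
  using noise_indep by (auto simp: indep_vars_def)

lemma scalar_prod_noise:
  "\<omega> \<in> space M \<Longrightarrow> u \<bullet> w \<omega> = (\<Sum>j<n. u $ j * w \<omega> $ j)"
  using w_carrier[of \<omega>] by (auto simp: scalar_prod_def atLeast0LessThan)

lemma scalar_prod_noise_measurable [measurable]:
  "(\<lambda>\<omega>. u \<bullet> w \<omega>) \<in> borel_measurable M"
proof -
  have "(\<lambda>\<omega>. \<Sum>j<n. u $ j * w \<omega> $ j) \<in> borel_measurable M"
    by (intro borel_measurable_sum borel_measurable_times) auto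
  then show ?thesis using scalar_prod_noise by (simp cong: measurable_cong)
qed

text \<open>By independence the moment generating function factors over the coordinates. The factor
  for \<open>j\<close> is controlled at \<open>t * u $ j\<close>, and the squares add up to
  \<open>t\<^sup>2 * sq_norm2 u\<close>.\<close>

lemma noise_exp_moment:
  assumes u: "u \<in> carrier_vec n"
  shows "integrable M (\<lambda>\<omega>. exp (t * (u \<bullet> w \<omega>)))"
    and "expectation (\<lambda>\<omega>. exp (t * (u \<bullet> w \<omega>))) \<le> exp (t\<^sup>2 * sq_norm2 u * \<sigma>\<^sup>2 / 2)"
proof -
  let ?Y = "\<lambda>j \<omega>. exp ((t * u $ j) * w \<omega> $ j)"
  have indep: "indep_vars (\<lambda>_. borel) ?Y {..<n}"
    by (rule indep_vars_compose2[OF noise_indep, of "\<lambda>j x. exp ((t * u $ j) * x)"]) simp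
  have int: "integrable M (?Y j)"
    and le: "expectation (?Y j) \<le> exp ((t * u $ j)\<^sup>2 * \<sigma>\<^sup>2 / 2)" if "j < n" for j
    using noise_sub_gaussian[OF that] unfolding zero_mean_sub_gaussian_def by blast+
  have prod: "exp (t * (u \<bullet> w \<omega>)) = (\<Prod>j<n. ?Y j \<omega>)" if "\<omega> \<in> space M" for \<omega>
    using scalar_prod_noise[OF that, of u]
    by (simp add: sum_distrib_left mult.assoc flip: exp_sum)
  have "integrable M (\<lambda>\<omega>. \<Prod>j<n. ?Y j \<omega>)"
    using indep int by (intro indep_vars_integrable) auto
  moreover have "integrable M (\<lambda>\<omega>. exp (t * (u \<bullet> w \<omega>))) \<longleftrightarrow> integrable M (\<lambda>\<omega>. \<Prod>j<n. ?Y j \<omega>)"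
    by (intro Bochner_Integration.integrable_cong refl prod)
  ultimately show "integrable M (\<lambda>\<omega>. exp (t * (u \<bullet> w \<omega>)))" by blast
  have "expectation (\<lambda>\<omega>. exp (t * (u \<bullet> w \<omega>))) = expectation (\<lambda>\<omega>. \<Prod>j<n. ?Y j \<omega>)"
    using prod by (rule Bochner_Integration.integral_cong[OF refl])
  also have "\<dots> = (\<Prod>j<n. expectation (?Y j))"
    using indep int by (intro indep_vars_lebesgue_integral) auto
  also have "\<dots> \<le> (\<Prod>j<n. exp ((t * u $ j)\<^sup>2 * \<sigma>\<^sup>2 / 2))"
    using le by (intro prod_mono) (auto intro!: integral_nonneg_AE)
  also have "\<dots> = exp (\<Sum>j<n. (t * u $ j)\<^sup>2 * \<sigma>\<^sup>2 / 2)"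
    by (simp add: exp_sum)
  also have "(\<Sum>j<n. (t * u $ j)\<^sup>2 * \<sigma>\<^sup>2 / 2) = t\<^sup>2 * sq_norm2 u * \<sigma>\<^sup>2 / 2"
    using u by (simp add: sq_norm2_def scalar_prod_def atLeast0LessThan power_mult_distrib
        sum_distrib_left sum_distrib_right sum_divide_distrib power2_eq_square mult_ac)
  finally show "expectation (\<lambda>\<omega>. exp (t * (u \<bullet> w \<omega>))) \<le> exp (t\<^sup>2 * sq_norm2 u * \<sigma>\<^sup>2 / 2)" .
qed

lemma noise_tail:
  assumes u: "u \<in> carrier_vec n" "sq_norm2 u \<le> \<tau>" and pos: "0 < \<tau>" "0 < t" "0 < \<sigma>"
  shows "prob {\<omega> \<in> space M. t \<le> u \<bullet> w \<omega>} \<le> exp (- (t\<^sup>2 / (2 * \<sigma>\<^sup>2 * \<tau>)))"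
proof -
  \<comment> \<open>This minimizes the Chernoff exponent
    \<open>- s * t + s\<^sup>2 * \<tau> * \<sigma>\<^sup>2 / 2\<close>.\<close>
  define s where "s = t / (\<sigma>\<^sup>2 * \<tau>)"
  have s: "s > 0" using pos by (simp add: s_def)
  have "prob {\<omega> \<in> space M. t \<le> u \<bullet> w \<omega>} \<le>
      exp (- s * t) * (\<integral>\<omega>\<in>space M. exp (s * (u \<bullet> w \<omega>)) \<partial>M)"
    using integrable_mult_indicator[OF sets.top noise_exp_moment(1)[OF u(1), of s]]
    by (intro Chernoff_ineq_ge s) (auto simp: set_integrable_def)
  also have "(\<integral>\<omega>\<in>space M. exp (s * (u \<bullet> w \<omega>)) \<partial>M) = expectation (\<lambda>\<omega>. exp (s * (u \<bullet> w \<omega>)))"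
    by (rule set_integral_space[OF noise_exp_moment(1)[OF u(1)]])
  also have "exp (- s * t) * \<dots> \<le> exp (- s * t) * exp (s\<^sup>2 * sq_norm2 u * \<sigma>\<^sup>2 / 2)"
    using noise_exp_moment(2)[OF u(1)] by simp
  also have "\<dots> \<le> exp (- s * t) * exp (s\<^sup>2 * \<tau> * \<sigma>\<^sup>2 / 2)"
    using u(2) by (intro mult_left_mono) (auto intro!: mult_left_mono mult_right_mono divide_right_mono)
  also have "\<dots> = exp (- (t\<^sup>2 / (2 * \<sigma>\<^sup>2 * \<tau>)))"
    unfolding exp_add[symmetric] using pos by (simp add: s_def field_simps power2_eq_square)
  finally show ?thesis .
qed

lemma noise_tail_abs:
  assumes u: "u \<in> carrier_vec n" "sq_norm2 u \<le> \<tau>" and pos: "0 < \<tau>" "0 < t" "0 < \<sigma>"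
  shows "prob {\<omega> \<in> space M. t \<le> \<bar>u \<bullet> w \<omega>\<bar>} \<le> 2 * exp (- (t\<^sup>2 / (2 * \<sigma>\<^sup>2 * \<tau>)))"
proof -
  have uw: "(- u) \<bullet> w \<omega> = - (u \<bullet> w \<omega>)" if "\<omega> \<in> space M" for \<omega>
    using u w_carrier[OF that] by (intro scalar_prod_uminus_left) auto
  have "sq_norm2 (- u) = sq_norm2 u" by (simp add: sq_norm2_def)
  then have "prob {\<omega> \<in> space M. t \<le> u \<bullet> w \<omega>} \<le> exp (- (t\<^sup>2 / (2 * \<sigma>\<^sup>2 * \<tau>)))"
    "prob {\<omega> \<in> space M. t \<le> (- u) \<bullet> w \<omega>} \<le> exp (- (t\<^sup>2 / (2 * \<sigma>\<^sup>2 * \<tau>)))"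
    using assms by (intro noise_tail; simp)+
  moreover have "prob {\<omega> \<in> space M. t \<le> \<bar>u \<bullet> w \<omega>\<bar>} \<le>
      prob ({\<omega> \<in> space M. t \<le> u \<bullet> w \<omega>} \<union> {\<omega> \<in> space M. t \<le> (- u) \<bullet> w \<omega>})"
    using uw by (intro finite_measure_mono) auto
  moreover have "\<dots> \<le> prob {\<omega> \<in> space M. t \<le> u \<bullet> w \<omega>} + prob {\<omega> \<in> space M. t \<le> (- u) \<bullet> w \<omega>}"
    by (intro measure_Un_le) auto
  ultimately show ?thesis by linarith
qed

section \<open>Bad events, union bounds and the recovery probability\<close>

lemma finite_support: "finite (support \<beta>)" and support_subset: "support \<beta> \<subseteq> {..<p}"
  using beta_carrier by (auto simp: support_def)

lemma beta_min_pos: "0 < beta_min \<beta>"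
proof -
  have "support \<beta> \<noteq> {}" using card_support k_pos by auto
  then show ?thesis
    using finite_support unfolding beta_min_def by (auto simp: support_def)
qed

text \<open>The failure is covered by a measurable event \<open>B\<close> built from linear
  functionals of the noise, which avoids measurability of \<open>loss\<close>. The constant 36 makes
  the exponents \<open>V / (18 * \<sigma>\<^sup>2)\<close> and
  \<open>V / (6 * \<sigma>\<^sup>2 * real l)\<close> at least \<open>2 * real l * L\<close>.\<close>

lemma loss_gap_event:
  assumes S: "S \<subseteq> {..<p}" "card S = k" and l: "card (support \<beta> - S) = l" "l \<in> {1, 2}"
    and \<sigma>: "0 < \<sigma>" and L: "0 < L" and rho: "0 \<le> rho X (support \<beta>) (2 * k)"
    and snr: "36 * \<sigma>\<^sup>2 * L \<le> rho X (support \<beta>) (2 * k) * (real n * (beta_min \<beta>)\<^sup>2)"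
  shows "\<exists>B\<in>events. prob B \<le> 5 * exp (- (2 * real l * L)) \<and>
    (\<forall>\<omega>\<in>space M - B. loss (y \<omega>) X (support \<beta>) < loss (y \<omega>) X S)"
proof -
  let ?T = "support \<beta>"
  have fS: "finite S" using S finite_subset by blast
  have cardST: "card (S - ?T) = l"
    using S(2) card_support l(1) fS finite_support by (simp add: card_Diff_subset_Int Int_commute)
  have Xb: "X *\<^sub>v \<beta> \<in> carrier_vec n" using X_carrier beta_carrier by simp
  obtain v where v: "is_resid X S (X *\<^sub>v \<beta>) v"
    using is_resid_exists[OF X_carrier S(1) Xb] by blast
  note vc = is_resid_carrier[OF X_carrier v Xb]
  obtain u where u: "\<And>b. b \<in> S - ?T \<Longrightarrow> u b \<in> carrier_vec n \<and> sq_norm2 (u b) \<le> 1"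
    and gap: "\<And>z. z \<in> carrier_vec n \<Longrightarrow> loss (X *\<^sub>v \<beta> + z) X ?T + sq_norm2 v + 2 * (v \<bullet> z)
      - (\<Sum>b\<in>S - ?T. (u b \<bullet> z)\<^sup>2) \<le> loss (X *\<^sub>v \<beta> + z) X S"
    using loss_gap[OF X_carrier beta_carrier S(1) v] by blast
  define V where "V = sq_norm2 v"
  have "card (S \<union> ?T) \<le> 2 * k" using card_Un_le[of S ?T] S(2) card_support by simp
  then have "rho X ?T (2 * k) * (real n * (real l * (beta_min \<beta>)\<^sup>2)) \<le> V"
    using signal_lower_bound[OF X_carrier beta_carrier S(1) v _ rho] l(1) by (simp add: V_def)
  moreover have "real l * (36 * \<sigma>\<^sup>2 * L) \<le> real l * (rho X ?T (2 * k) * (real n * (beta_min \<beta>)\<^sup>2))"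
    using snr by (intro mult_left_mono) auto
  ultimately have V: "36 * \<sigma>\<^sup>2 * (real l * L) \<le> V" by (simp add: mult_ac)
  have lpos: "0 < real l" "real l \<le> 2" using l(2) by auto
  then have "0 < 36 * \<sigma>\<^sup>2 * (real l * L)" using \<sigma> L by simp
  then have Vpos: "0 < V" using V by linarith
  \<comment> \<open>If no event below occurs, the cross term costs less than \<open>2 V / 3\<close> and the \<open>l\<close> squares
    together less than \<open>V / 3\<close>.\<close>
  let ?A = "{\<omega> \<in> space M. V / 3 \<le> (- v) \<bullet> w \<omega>}"
  let ?B = "\<lambda>b. {\<omega> \<in> space M. sqrt (V / (3 * real l)) \<le> \<bar>u b \<bullet> w \<omega>\<bar>}"
  have "prob ?A \<le> exp (- ((V / 3)\<^sup>2 / (2 * \<sigma>\<^sup>2 * V)))"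
    using vc Vpos \<sigma> by (intro noise_tail) (auto simp: V_def sq_norm2_def)
  also have "(V / 3)\<^sup>2 / (2 * \<sigma>\<^sup>2 * V) = V / (18 * \<sigma>\<^sup>2)"
    using Vpos \<sigma> by (simp add: field_simps power2_eq_square)
  also have "exp (- (V / (18 * \<sigma>\<^sup>2))) \<le> exp (- (2 * real l * L))"
    using V \<sigma> by (simp add: pos_le_divide_eq mult_ac)
  finally have B0: "prob ?A \<le> exp (- (2 * real l * L))" .
  have Bb: "prob (?B b) \<le> 2 * exp (- (2 * real l * L))" if b: "b \<in> S - ?T" for b
  proof -
    have "prob (?B b) \<le> 2 * exp (- ((sqrt (V / (3 * real l)))\<^sup>2 / (2 * \<sigma>\<^sup>2 * 1)))"
      using u[OF b] Vpos lpos \<sigma> by (intro noise_tail_abs) auto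
    also have "(sqrt (V / (3 * real l)))\<^sup>2 / (2 * \<sigma>\<^sup>2 * 1) = V / (6 * \<sigma>\<^sup>2 * real l)"
      using Vpos lpos by simp
    also have "2 * exp (- (V / (6 * \<sigma>\<^sup>2 * real l))) \<le> 2 * exp (- (6 * L))"
      using V \<sigma> lpos by (simp add: pos_le_divide_eq mult_ac)
    \<comment> \<open>This uses \<open>l \<le> 2\<close>.\<close>
    also have "\<dots> \<le> 2 * exp (- (2 * real l * L))"
      using lpos L by simp
    finally show ?thesis .
  qed
  let ?E = "?A \<union> (\<Union>b\<in>S - ?T. ?B b)"
  have ev: "?A \<in> events" "\<And>b. ?B b \<in> events" by measurable
  have "prob ?E \<le> prob ?A + prob (\<Union>b\<in>S - ?T. ?B b)"
    using ev fS by (intro measure_Un_le) auto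
  also have "prob (\<Union>b\<in>S - ?T. ?B b) \<le> (\<Sum>b\<in>S - ?T. prob (?B b))"
    using ev fS by (intro measure_UNION_le) auto
  also have "\<dots> \<le> (\<Sum>b\<in>S - ?T. 2 * exp (- (2 * real l * L)))"
    by (intro sum_mono Bb)
  also have "\<dots> = 2 * real l * exp (- (2 * real l * L))" by (simp add: cardST)
  also have "\<dots> \<le> 4 * exp (- (2 * real l * L))" using lpos by simp
  \<comment> \<open>One one-sided tail and at most two two-sided ones:
    \<open>1 + 2 * l \<le> 5\<close>.\<close>
  finally have prob_E: "prob ?E \<le> 5 * exp (- (2 * real l * L))" using B0 by simp
  have "loss (y \<omega>) X ?T < loss (y \<omega>) X S" if \<omega>: "\<omega> \<in> space M - ?E" for \<omega>
  proof -
    have wc: "w \<omega> \<in> carrier_vec n" using w_carrier \<omega> by blast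
    have "(- v) \<bullet> w \<omega> = - (v \<bullet> w \<omega>)" using vc wc by (intro scalar_prod_uminus_left) auto
    then have cross: "- (v \<bullet> w \<omega>) < V / 3" using \<omega> by auto
    have "(u b \<bullet> w \<omega>)\<^sup>2 \<le> V / (3 * real l)" if "b \<in> S - ?T" for b
    proof -
      have "\<bar>u b \<bullet> w \<omega>\<bar> \<le> sqrt (V / (3 * real l))" using \<omega> that by force
      then show ?thesis using Vpos lpos by (simp add: abs_le_square_iff real_le_rsqrt sqrt_ge_absD)
    qed
    then have "(\<Sum>b\<in>S - ?T. (u b \<bullet> w \<omega>)\<^sup>2) \<le> (\<Sum>b\<in>S - ?T. V / (3 * real l))"
      by (rule sum_mono)
    also have "\<dots> = V / 3" using lpos by (simp add: cardST)
    finally show ?thesis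
      using gap[OF wc] cross y_eq[of \<omega>] \<omega> unfolding V_def[symmetric] by auto
  qed
  then show ?thesis using prob_E ev fS by (intro bexI[of _ ?E]) auto
qed

lemma loss_gap_event_distance:
  assumes l: "l \<in> {1, 2}" and \<sigma>: "0 < \<sigma>" and L: "0 < L" and rho: "0 \<le> rho X (support \<beta>) (2 * k)"
    and snr: "36 * \<sigma>\<^sup>2 * L \<le> rho X (support \<beta>) (2 * k) * (real n * (beta_min \<beta>)\<^sup>2)"
  shows "\<exists>B\<in>events. prob B \<le> 5 * real ((k * (p - k)) ^ l) * exp (- (2 * real l * L)) \<and>
    (\<forall>\<omega>\<in>space M - B. \<forall>S. S \<subseteq> {..<p} \<longrightarrow> card S = k \<longrightarrow> card (support \<beta> - S) = l \<longrightarrow>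
      loss (y \<omega>) X (support \<beta>) < loss (y \<omega>) X S)"
proof -
  let ?\<C> = "{S. S \<subseteq> {..<p} \<and> card S = k \<and> card (support \<beta> - S) = l}"
  have fC: "finite ?\<C>" by (rule finite_subset[of _ "Pow {..<p}"]) auto
  \<comment> \<open>One bad event is chosen per support; outside their union the gap holds for all
    these supports at once.\<close>
  have "\<exists>B. \<forall>S\<in>?\<C>. B S \<in> events \<and> prob (B S) \<le> 5 * exp (- (2 * real l * L)) \<and>
    (\<forall>\<omega>\<in>space M - B S. loss (y \<omega>) X (support \<beta>) < loss (y \<omega>) X S)"
    using loss_gap_event[OF _ _ _ l \<sigma> L rho snr] by (intro bchoice) blast
  then obtain B where B: "\<And>S. S \<in> ?\<C> \<Longrightarrow> B S \<in> events"
    "\<And>S. S \<in> ?\<C> \<Longrightarrow> prob (B S) \<le> 5 * exp (- (2 * real l * L))"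
    "\<And>S \<omega>. S \<in> ?\<C> \<Longrightarrow> \<omega> \<in> space M - B S \<Longrightarrow> loss (y \<omega>) X (support \<beta>) < loss (y \<omega>) X S"
    by blast
  have "prob (\<Union>S\<in>?\<C>. B S) \<le> (\<Sum>S\<in>?\<C>. prob (B S))"
    using B(1) fC by (intro measure_UNION_le) auto
  also have "\<dots> \<le> (\<Sum>S\<in>?\<C>. 5 * exp (- (2 * real l * L)))"
    using B(2) by (intro sum_mono) auto
  also have "\<dots> = 5 * real (card ?\<C>) * exp (- (2 * real l * L))" by simp
  also have "\<dots> \<le> 5 * real ((k * (p - k)) ^ l) * exp (- (2 * real l * L))"
    using card_sets_at_distance_le[OF _ support_subset, of l]
    by (intro mult_right_mono mult_left_mono of_nat_mono) (auto simp: card_support)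
  finally show ?thesis
    using B(1,3) fC by (intro bexI[of _ "\<Union>S\<in>?\<C>. B S"]) auto
qed

text \<open>Distances 1 and 2 each contribute a bad event of probability at most
  \<open>5 * E\<close>, and \<open>E\<close> is at most \<open>1 / (real p - 1)\<close> because
  \<open>k * (p - k)\<close> is at least \<open>p - 1\<close>.\<close>

lemma swap_recovery_prob:
  assumes \<sigma>: "0 < \<sigma>" and kp: "k < p" and rho: "0 \<le> rho X (support \<beta>) (2 * k)"
    and snr: "36 * \<sigma>\<^sup>2 * (4 + ln ((real k)\<^sup>2 * (real p - real k)))
      \<le> rho X (support \<beta>) (2 * k) * (real n * (beta_min \<beta>)\<^sup>2)"
    and S1: "\<And>\<omega>. \<omega> \<in> space M \<Longrightarrow>
      S1 \<omega> \<subseteq> {..<p} \<and> card (S1 \<omega>) = k \<and> card (support \<beta> - S1 \<omega>) \<le> 1"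
    and meas: "Shat \<in> measurable M (count_space UNIV)"
    and out: "\<And>\<omega>. \<omega> \<in> space M \<Longrightarrow> swap_output (y \<omega>) X (S1 \<omega>) (Shat \<omega>)"
  shows "1 - 10 / (real p - 1) \<le> prob {\<omega> \<in> space M. Shat \<omega> = support \<beta>}"
proof -
  define L where "L = 4 + ln ((real k)\<^sup>2 * (real p - real k))"
  define E where "E = exp (- L)"
  define N where "N = real k * (real p - real k)"
  have k1: "1 \<le> real k" and pk: "1 \<le> real p - real k" using k_pos kp by auto
  \<comment> \<open>This product equals \<open>N - (real p - 1)\<close>.\<close>
  have "0 \<le> (real k - 1) * (real p - real k - 1)" using k1 pk by (intro mult_nonneg_nonneg) auto
  then have N_ge: "real p - 1 \<le> N" by (simp add: N_def algebra_simps)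
  have N1: "1 \<le> N" unfolding N_def using mult_mono[OF k1 pk] by simp
  have kN: "(real k)\<^sup>2 * (real p - real k) = real k * N" by (simp add: N_def power2_eq_square)
  have N_le: "N \<le> real k * N" using k1 N1 by simp
  then have ln_ge: "ln N \<le> L" "0 \<le> ln N"
    unfolding L_def kN using N1 by (auto intro: order_trans[of _ "ln (real k * N)"])
  have "0 \<le> ln (real k * N)" using N_le N1 by (intro ln_ge_zero) linarith
  then have L: "0 < L" by (simp add: L_def kN)
  have NE: "N * E \<le> 1"
  proof -
    have "N = exp (ln N)" using N1 by simp
    also have "\<dots> \<le> exp L" using ln_ge by simp
    finally have "N * E \<le> exp L * E" by (intro mult_right_mono) (auto simp: E_def)
    then show ?thesis by (simp add: E_def exp_minus)
  qed
  have E0: "0 < E" "E \<le> 1" using L by (auto simp: E_def)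
  have E_le: "E \<le> 1 / (real p - 1)"
  proof -
    have "(real p - 1) * E \<le> N * E" using N_ge E0 by (intro mult_right_mono) auto
    then show ?thesis using NE pk k1 by (simp add: field_simps)
  qed
  have "\<exists>B\<in>events. prob B \<le> 5 * E \<and>
    (\<forall>\<omega>\<in>space M - B. \<forall>S. S \<subseteq> {..<p} \<longrightarrow> card S = k \<longrightarrow> card (support \<beta> - S) = l \<longrightarrow>
      loss (y \<omega>) X (support \<beta>) < loss (y \<omega>) X S)" if l: "l \<in> {1, 2}" for l
  proof -
    \<comment> \<open>The exponent is split in half: one factor \<open>E ^ l\<close> absorbs the
      number of supports, the other provides the decay.\<close>
    have "real ((k * (p - k)) ^ l) * exp (- (2 * real l * L)) = (N * E) ^ l * E ^ l"
      using kp by (simp add: N_def E_def of_nat_diff power_mult_distrib flip: exp_of_nat_mult exp_add)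
    also have "\<dots> \<le> 1 * E"
    proof (intro mult_mono)
      show "(N * E) ^ l \<le> 1" using NE E0 N1 by (intro power_le_one) auto
      show "E ^ l \<le> E" using l E0 by (auto simp: power2_eq_square mult_left_le)
    qed (use E0 N1 in auto)
    finally have "5 * real ((k * (p - k)) ^ l) * exp (- (2 * real l * L)) \<le> 5 * E" by simp
    then show ?thesis
      using loss_gap_event_distance[OF l \<sigma> L rho snr[folded L_def]] by (meson order_trans)
  qed
  from this[of 1] this[of 2] obtain B1 B2 where
    B: "B1 \<in> events" "B2 \<in> events" "prob B1 \<le> 5 * E" "prob B2 \<le> 5 * E"
    and gap1: "\<And>\<omega> S. \<omega> \<in> space M - B1 \<Longrightarrow> S \<subseteq> {..<p} \<Longrightarrow> card S = k \<Longrightarrow>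
      card (support \<beta> - S) = 1 \<Longrightarrow> loss (y \<omega>) X (support \<beta>) < loss (y \<omega>) X S"
    and gap2: "\<And>\<omega> S. \<omega> \<in> space M - B2 \<Longrightarrow> S \<subseteq> {..<p} \<Longrightarrow> card S = k \<Longrightarrow>
      card (support \<beta> - S) = 2 \<Longrightarrow> loss (y \<omega>) X (support \<beta>) < loss (y \<omega>) X S"
    by (metis insertI1 insertI2)
  let ?G = "{\<omega> \<in> space M. Shat \<omega> = support \<beta>}"
  have G: "?G \<in> events" using meas by measurable
  have "\<omega> \<in> ?G" if \<omega>: "\<omega> \<in> space M - (B1 \<union> B2)" for \<omega>
  proof -
    have dim: "dim_col X = p" using X_carrier by auto
    have "Shat \<omega> = support \<beta>"
      using \<omega> S1[of \<omega>] gap1[of \<omega>] gap2[of \<omega>] support_subset out[of \<omega>]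
      by (intro swap_output_eq_strict_minimizer[of "y \<omega>" X "S1 \<omega>"]) (auto simp: dim card_support)
    then show ?thesis using \<omega> by blast
  qed
  then have "space M - ?G \<subseteq> B1 \<union> B2" by blast
  then have "1 - prob ?G \<le> prob (B1 \<union> B2)"
    using B G finite_measure_mono[of "space M - ?G" "B1 \<union> B2"] prob_compl[OF G] by auto
  also have "\<dots> \<le> 10 * E" using measure_Un_le[OF B(1,2)] B(3,4) by linarith
  also have "\<dots> \<le> 10 / (real p - 1)" using E_le by simp
  finally show ?thesis by linarith
qed

text \<open>The true support has \<open>k\<close> elements within \<open>{..<p}\<close>, so here it
  is all of \<open>{..<p}\<close> and SWAP has no other set to return. This case is separate because
  the logarithm in the sample size condition calls for \<open>k < p\<close>.\<close>

lemma swap_recovery_full: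
  assumes kp: "p \<le> k"
    and S1: "\<And>\<omega>. \<omega> \<in> space M \<Longrightarrow>
      S1 \<omega> \<subseteq> {..<p} \<and> card (S1 \<omega>) = k \<and> card (support \<beta> - S1 \<omega>) \<le> 1"
    and out: "\<And>\<omega>. \<omega> \<in> space M \<Longrightarrow> swap_output (y \<omega>) X (S1 \<omega>) (Shat \<omega>)"
  shows "prob {\<omega> \<in> space M. Shat \<omega> = support \<beta>} = 1"
proof -
  have full: "S = support \<beta>" if "S \<subseteq> {..<p}" "card S = k" for S
  proof -
    have "U = {..<p}" if "U \<subseteq> {..<p}" "card U = k" for U
      using that kp card_mono[OF _ that(1)] by (intro card_subset_eq) auto
    then show ?thesis using that support_subset card_support by metis
  qed
  have dim: "dim_col X = p" using X_carrier by auto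
  have "Shat \<omega> = support \<beta>" if \<omega>: "\<omega> \<in> space M" for \<omega>
  proof (rule swap_output_eq_strict_minimizer[OF out[OF \<omega>]])
    \<comment> \<open>The gap condition is vacuous: such an \<open>S\<close> equals the true
      support, so nothing is missed.\<close>
    fix S assume "S \<subseteq> {..<dim_col X}" "card S = card (support \<beta>)" "card (support \<beta> - S) \<in> {1, 2}"
    then show "loss (y \<omega>) X (support \<beta>) < loss (y \<omega>) X S" using full[of S] by (simp add: dim card_support)
  qed (use S1[OF \<omega>] support_subset in \<open>auto simp: dim card_support\<close>)
  then have "{\<omega> \<in> space M. Shat \<omega> = support \<beta>} = space M" by blast
  then show ?thesis by (simp add: prob_space)
qed

end

section \<open>Passage to the limit along the sequence of problems\<close>

theorem theorem3:
  fixes M :: "nat \<Rightarrow> 'a measure"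
    and n k :: "nat \<Rightarrow> nat"
    and X :: "nat \<Rightarrow> real mat"
    and \<beta> :: "nat \<Rightarrow> real vec"
    and w y :: "nat \<Rightarrow> 'a \<Rightarrow> real vec"
    and S1 Shat :: "nat \<Rightarrow> 'a \<Rightarrow> nat set"
    and \<sigma> c :: real
  assumes "\<sigma> > 0"
    and "0 < c\<^sup>2" and "c\<^sup>2 \<le> 1 / (18 * \<sigma>\<^sup>2)"
    and "\<And>p. 1 \<le> p \<Longrightarrow> sparse_regression (M p) p (n p) (k p) \<sigma> (X p) (\<beta> p) (w p) (y p)"
    and "\<And>p. 1 \<le> p \<Longrightarrow> rho (X p) (support (\<beta> p)) (2 * k p) > 0"
    and "\<And>p \<omega>. 1 \<le> p \<Longrightarrow> \<omega> \<in> space (M p) \<Longrightarrow>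
           S1 p \<omega> \<subseteq> {..<p} \<and> card (S1 p \<omega>) = k p \<and> card (support (\<beta> p) - S1 p \<omega>) \<le> 1"
    and "\<And>p. 1 \<le> p \<Longrightarrow> Shat p \<in> measurable (M p) (count_space UNIV)"
    and "\<And>p \<omega>. 1 \<le> p \<Longrightarrow> \<omega> \<in> space (M p) \<Longrightarrow>
           swap_output (y p \<omega>) (X p) (S1 p \<omega>) (Shat p \<omega>)"
    and "\<And>p. 1 \<le> p \<Longrightarrow> k p < p \<Longrightarrow>
           real (n p) > (4 + ln ((real (k p))\<^sup>2 * (real p - real (k p))))
             / (c\<^sup>2 * (beta_min (\<beta> p))\<^sup>2 * rho (X p) (support (\<beta> p)) (2 * k p) / 2)"
  shows "(\<lambda>p. measure (M p) {\<omega> \<in> space (M p). Shat p \<omega> = support (\<beta> p)}) \<longlonglongrightarrow> 1"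
proof -
  let ?P = "\<lambda>p. measure (M p) {\<omega> \<in> space (M p). Shat p \<omega> = support (\<beta> p)}"
  \<comment> \<open>Restricting to \<open>2 \<le> p\<close> keeps the denominator positive; finitely
    many indices do not affect the limit.\<close>
  have lower: "1 - 10 / (real p - 1) \<le> ?P p" and upper: "?P p \<le> 1" if p: "2 \<le> p" for p
  proof -
    have p1: "1 \<le> p" using p by simp
    interpret sparse_regression "M p" p "n p" "k p" \<sigma> "X p" "\<beta> p" "w p" "y p"
      by (rule assms(4)[OF p1])
    show "?P p \<le> 1" by simp
    show "1 - 10 / (real p - 1) \<le> ?P p"
    proof (cases "k p < p")
      case False
      then have "?P p = 1"
        using assms(6,8)[OF p1] by (intro swap_recovery_full[of "S1 p"]) auto
      then show ?thesis using p by simp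
    next
      case True
      define L where "L = 4 + ln ((real (k p))\<^sup>2 * (real p - real (k p)))"
      define R where "R = (beta_min (\<beta> p))\<^sup>2 * rho (X p) (support (\<beta> p)) (2 * k p)"
      have R: "0 < R" using beta_min_pos assms(5)[OF p1] by (simp add: R_def)
      have "1 * 1 \<le> (real (k p))\<^sup>2 * (real p - real (k p))"
        using True k_pos by (intro mult_mono) (auto simp: one_le_power)
      then have L: "0 < L" by (simp add: L_def add_pos_nonneg)
      have "L / (c\<^sup>2 * R / 2) < real (n p)"
        using assms(9)[OF p1 True] by (simp add: L_def R_def mult.assoc)
      then have "2 * L \<le> c\<^sup>2 * (real (n p) * R)"
        using R assms(2) by (simp add: field_simps)
      \<comment> \<open>The bound on \<open>c\<^sup>2\<close> enters here; with the factor 2 from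
        the sample size condition it produces the constant 36.\<close>
      also have "\<dots> \<le> 1 / (18 * \<sigma>\<^sup>2) * (real (n p) * R)"
        using R assms(3) by (intro mult_right_mono) auto
      finally have "36 * \<sigma>\<^sup>2 * L \<le> real (n p) * R"
        using assms(1) by (simp add: field_simps)
      then have "36 * \<sigma>\<^sup>2 * L \<le> rho (X p) (support (\<beta> p)) (2 * k p) * (real (n p) * (beta_min (\<beta> p))\<^sup>2)"
        by (simp add: R_def mult_ac)
      then show ?thesis
        using assms(6)[OF p1] assms(8)[OF p1] less_imp_le[OF assms(5)[OF p1]]
        unfolding L_def by (intro swap_recovery_prob[OF assms(1) True _ _ _ assms(7)[OF p1], of "S1 p"]) auto
    qed
  qed
  have "((\<lambda>p. 1 - 10 / (real p - 1)) \<longlongrightarrow> 1) sequentially" by real_asymp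
  then show ?thesis
  proof (rule tendsto_sandwich[rotated 2])
    show "\<forall>\<^sub>F p in sequentially. 1 - 10 / (real p - 1) \<le> ?P p"
      using lower by (auto intro: eventually_sequentiallyI[of 2])
    show "\<forall>\<^sub>F p in sequentially. ?P p \<le> 1"
      using upper by (auto intro: eventually_sequentiallyI[of 2])
  qed simp
qed

end
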